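(* Let $(q,p_0,\omega)$ be a pp-solution of $7x^2+59y^2=3^m$, so that $7q^2+59p_0^2=3^{\omega}$. Then $3\nmid p_0q$. Let $p\in\{p_0,-p_0\}$ be the choice of sign for which $pq\equiv -1\pmod 3$. Set $$x=3^{-5}|A(p,q)|,\quad y=3^{-5}|B(p,q)|,\quad x'=|A(-p,q)|,\quad y'=|B(-p,q)|.$$ Then $(x,y,2\omega-5)$ is a pp-solution of $7x^2+59y^2=3^m$ (called the first successor of $(q,p_0,\omega)$), and $(x',y',2\omega+5)$ is a pp-solution of $7x^2+59y^2=3^m$ (called the second successor of $(q,p_0,\omega)$).
   Context: A solution of $7x^2+59y^2=3^m$ means a triple $(x,y,m)$ of non-zero integers with $m>0$ satisfying the equation. A pp-solution is a solution with $x,y>0$ and $\gcd(x,y)=1$. For non-zero integers $p,q$ define $$A(p,q)=59p^2-236pq-7q^2,\qquad B(p,q)=-118p^2-14pq+14q^2.$$ *)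

theory Defs
  imports Complex_Main "HOL-Number_Theory.Cong"
begin

definition is_solution :: "int \<Rightarrow> int \<Rightarrow> int \<Rightarrow> bool" where
  "is_solution x y m \<longleftrightarrow> x \<noteq> 0 \<and> y \<noteq> 0 \<and> m > 0 \<and> 7 * x^2 + 59 * y^2 = 3 ^ nat m"

definition pp_solution :: "int \<Rightarrow> int \<Rightarrow> int \<Rightarrow> bool" where
  "pp_solution x y m \<longleftrightarrow> is_solution x y m \<and> x > 0 \<and> y > 0 \<and> gcd x y = 1"

definition A :: "int \<Rightarrow> int \<Rightarrow> int" where
  "A p q = 59 * p^2 - 236 * p * q - 7 * q^2"

definition B :: "int \<Rightarrow> int \<Rightarrow> int" where
  "B p q = - 118 * p^2 - 14 * p * q + 14 * q^2"

end

theory Submission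
  imports Defs
begin

text \<open>
  The maps \<open>A\<close> and \<open>B\<close> come from composing binary forms. Put \<open>\<alpha> = q \<surd>7 + p \<surd>(-59)\<close> and let
  \<open>\<beta> = - \<surd>7 + 2 \<surd>(-59)\<close> be the element attached to the equation \<open>7 \<cdot> 1\<^sup>2 + 59 \<cdot> 2\<^sup>2 = 3\<^sup>5\<close>.
  Then \<open>A p q\<close> and \<open>B p q\<close> are the coordinates of \<open>\<alpha>\<^sup>2 \<beta>\<close> with respect to \<open>\<surd>7\<close> and \<open>\<surd>(-59)\<close>, so
  taking norms multiplies \<open>(7 q\<^sup>2 + 59 p\<^sup>2)\<^sup>2\<close> by \<open>3\<^sup>5\<close> (lemma \<open>norm_A_B\<close>). Hence both
  \<open>(A p q, B p q)\<close> and \<open>(A (- p) q, B (- p) q)\<close> represent \<open>3\<close> to the power \<open>2\<omega> + 5\<close>, and everything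
  else is the question how often 3 divides them.

  That is controlled by the product of the two first coordinates, which is
  \<open>(7 q\<^sup>2 + 59 p\<^sup>2)\<^sup>2 - 236 \<cdot> 3\<^sup>5 (p q)\<^sup>2\<close> (lemma \<open>A_times_A_minus\<close>). Since \<open>\<omega> \<ge> 4\<close> and \<open>p q\<close> is
  prime to 3, the exact power of 3 dividing it is \<open>3\<^sup>5\<close>. The congruence \<open>p q \<equiv> -1\<close> modulo 3
  makes \<open>A (- p) q\<close> prime to 3, so the whole power \<open>3\<^sup>5\<close> sits in \<open>A p q\<close>, and the norm equation
  forces \<open>3\<^sup>5\<close> into \<open>B p q\<close> as well. In both successors the first coordinate is then prime to 3,
  which is enough for a representation of a power of 3 to be primitive with both coordinates
  non-zero (lemma \<open>pp_solution_abs\<close>).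
\<close>

lemma norm_A_B: "7 * (A p q)^2 + 59 * (B p q)^2 = 3 ^ 5 * (7 * q^2 + 59 * p^2)^2"
  unfolding A_def B_def by algebra

lemma A_times_A_minus:
  "A p q * A (- p) q = (7 * q^2 + 59 * p^2)^2 - 3 ^ 5 * (236 * (p * q)^2)"
  unfolding A_def by algebra

text \<open>
  A common divisor of the coordinates divides a power of 3 and is prime to 3, hence is a unit; and
  the second coordinate cannot vanish because 7 does not divide a power of 3.
\<close>

lemma pp_solution_abs:
  fixes x y m :: int
  assumes eq: "7 * x^2 + 59 * y^2 = 3 ^ nat m" and "m > 0" and x: "\<not> 3 dvd x"
  shows "pp_solution \<bar>x\<bar> \<bar>y\<bar> m"
proof -
  have "x \<noteq> 0"
    using x by auto
  have "y \<noteq> 0"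
  proof
    assume "y = 0"
    then have "(7::int) dvd 3 ^ nat m"
      using eq by (metis dvd_triv_left mult_zero_right add.right_neutral zero_power2)
    moreover have "coprime (7::int) (3 ^ nat m)"
      using prime_imp_coprime[of "3::int" 7] by (simp add: coprime_commute)
    ultimately have "is_unit (7::int)"
      using coprime_common_divisor[of 7 "3 ^ nat m" "7::int"] by (simp only: dvd_refl simp_thms)
    then show False
      by simp
  qed
  have "coprime x 3"
    using x prime_imp_coprime[of 3 x] by (simp add: coprime_commute)
  have "coprime x y"
  proof (rule coprimeI)
    fix d assume d: "d dvd x" "d dvd y"
    then have "d dvd 7 * x^2 + 59 * y^2"
      by (simp add: power2_eq_square)
    then have "d dvd 3 ^ nat m"
      using eq by simp
    moreover have "coprime d (3 ^ nat m)"
      using \<open>coprime x 3\<close> d(1) coprime_divisors[of d x 3 3] by simp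
    ultimately show "is_unit d"
      by (metis coprime_common_divisor dvd_refl)
  qed
  then show ?thesis
    using eq \<open>m > 0\<close> \<open>x \<noteq> 0\<close> \<open>y \<noteq> 0\<close>
    by (simp add: pp_solution_def is_solution_def)
qed

text \<open>
  The form \<open>7 x\<^sup>2 + 59 y\<^sup>2\<close> takes a value of at least \<open>7 + 59\<close>, which exceeds \<open>3\<^sup>3\<close>. This bound makes \<open>2m - 5\<close> positive
  and leaves a factor 3 over when \<open>3\<^sup>5\<close> is split off \<open>3\<close> to the power \<open>2m\<close>.
\<close>

lemma pp_solution_exponent_ge_4:
  assumes "pp_solution x y m"
  shows "m \<ge> 4"
proof (rule ccontr)
  assume "\<not> m \<ge> 4"
  then have "(3::int) ^ nat m \<le> 3 ^ 3"
    by (intro power_increasing) auto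
  moreover have "1 \<le> x^2" "1 \<le> y^2"
    using assms by (auto simp: pp_solution_def)
  ultimately show False
    using assms by (simp add: pp_solution_def is_solution_def)
qed

lemma pp_solution_prime_to_3:
  assumes "pp_solution x y m"
  shows "\<not> 3 dvd x" "\<not> 3 dvd y"
proof -
  have eq: "7 * x^2 + 59 * y^2 = 3 ^ nat m" and "nat m > 0" and cop: "gcd x y = 1"
    using assms by (auto simp: pp_solution_def is_solution_def)
  have 3: "3 dvd 7 * x^2 + 59 * y^2"
    using eq \<open>nat m > 0\<close> by (simp add: dvd_power)
  have pr: "prime (3::int)"
    by simp
  have "3 dvd x \<longleftrightarrow> 3 dvd y"
  proof
    assume "3 dvd x"
    then have "3 dvd 59 * y^2"
      using 3 by (simp add: power2_eq_square dvd_add_right_iff)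
    then show "3 dvd y"
      using pr by (simp add: prime_dvd_mult_iff prime_dvd_power_iff)
  next
    assume "3 dvd y"
    then have "3 dvd 7 * x^2"
      using 3 by (simp add: power2_eq_square dvd_add_left_iff)
    then show "3 dvd x"
      using pr by (simp add: prime_dvd_mult_iff prime_dvd_power_iff)
  qed
  moreover have "\<not> (3 dvd x \<and> 3 dvd y)"
    using cop by (metis gcd_greatest_iff zdvd1_eq abs_numeral numeral_eq_one_iff num.distinct(3))
  ultimately show "\<not> 3 dvd x" "\<not> 3 dvd y"
    by auto
qed

text \<open>
  If \<open>p q \<equiv> -1\<close> modulo 3, then \<open>p\<^sup>2 \<equiv> q\<^sup>2 \<equiv> 1\<close>, and \<open>A (- p) q\<close> reduces to
  \<open>59 - 236 - 7 \<equiv> 2\<close>.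
\<close>

lemma A_minus_prime_to_3:
  assumes "[p * q = - 1] (mod 3)"
  shows "\<not> 3 dvd A (- p) q"
proof -
  have "p mod 3 = 0 \<or> p mod 3 = 1 \<or> p mod 3 = 2" "q mod 3 = 0 \<or> q mod 3 = 1 \<or> q mod 3 = 2"
    by presburger+
  moreover have "(p mod 3) * (q mod 3) mod 3 = 2"
    using assms by (simp add: cong_def mod_mult_eq)
  ultimately have "p mod 3 = 1 \<and> q mod 3 = 2 \<or> p mod 3 = 2 \<and> q mod 3 = 1"
    by auto
  then obtain a b where "p = 3 * a + 1 \<and> q = 3 * b + 2 \<or> p = 3 * a + 2 \<and> q = 3 * b + 1"
    by (metis mult_div_mod_eq)
  then have "\<exists>c. A (- p) q = 3 * c + 2"
  proof
    assume "p = 3 * a + 1 \<and> q = 3 * b + 2"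
    then have "A (- p) q = 3 * (177*a^2 + 118*a + 708*a*b + 472*a + 236*b - 21*b^2 - 28*b + 167) + 2"
      unfolding A_def by (simp add: power2_eq_square algebra_simps)
    then show ?thesis ..
  next
    assume "p = 3 * a + 2 \<and> q = 3 * b + 1"
    then have "A (- p) q = 3 * (177*a^2 + 236*a + 708*a*b + 236*a + 472*b - 21*b^2 - 14*b + 233) + 2"
      unfolding A_def by (simp add: power2_eq_square algebra_simps)
    then show ?thesis ..
  qed
  then show ?thesis
    by presburger
qed

lemma unique_sign_cong_minus_one_mod_3:
  fixes p q :: int
  assumes "\<not> 3 dvd p * q"
  shows "\<exists>!r. r \<in> {p, - p} \<and> [r * q = - 1] (mod 3)"
proof -
  have "p * q mod 3 = 1 \<or> p * q mod 3 = 2"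
    using assms by presburger
  moreover have "[r * q = - 1] (mod 3) \<longleftrightarrow> r * q mod 3 = 2" for r
    by (simp add: cong_def)
  moreover have "- p * q mod 3 = 2 \<longleftrightarrow> p * q mod 3 = 1"
    by (simp, presburger)
  ultimately show ?thesis
    by auto
qed

lemma second_successor:
  fixes p q m :: int
  assumes "7 * q^2 + 59 * p^2 = 3 ^ nat m" "m > 0" "[p * q = - 1] (mod 3)"
  shows "pp_solution \<bar>A (- p) q\<bar> \<bar>B (- p) q\<bar> (2 * m + 5)"
proof (rule pp_solution_abs)
  have "nat (2 * m + 5) = 5 + nat m * 2"
    using \<open>m > 0\<close> by simp
  then show "7 * (A (- p) q)^2 + 59 * (B (- p) q)^2 = 3 ^ nat (2 * m + 5)"
    using norm_A_B[of "- p" q] assms(1) by (simp only: power_add power_mult power2_minus)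
  show "\<not> 3 dvd A (- p) q"
    using assms(3) by (rule A_minus_prime_to_3)
qed (use \<open>m > 0\<close> in simp)

text \<open>
  The factor \<open>3\<^sup>5\<close> moves from the product \<open>A p q * A (- p) q\<close> into \<open>A p q\<close>. After it is divided
  out, the product is \<open>- 236 (p q)\<^sup>2\<close> modulo 3, so no further 3 is left in \<open>A p q\<close>.
\<close>

lemma first_successor:
  fixes p q m :: int
  assumes eq: "7 * q^2 + 59 * p^2 = 3 ^ nat m" and m: "m \<ge> 4" and pq: "[p * q = - 1] (mod 3)"
  shows "\<exists>x y. A p q = 3 ^ 5 * x \<and> B p q = 3 ^ 5 * y \<and> pp_solution \<bar>x\<bar> \<bar>y\<bar> (2 * m - 5)"
proof -
  define k where "k = nat (2 * m - 5)"
  have "k \<ge> 3" and "nat m * 2 = 5 + k"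
    using m by (auto simp: k_def)
  then have N: "(7 * q^2 + 59 * p^2)^2 = 3 ^ 5 * 3 ^ k"
    using eq by (metis power_add power_mult)
  have prod: "A p q * A (- p) q = 3 ^ 5 * (3 ^ k - 236 * (p * q)^2)"
    unfolding A_times_A_minus N by (simp add: right_diff_distrib)
  have "coprime (3 ^ 5) (A (- p) q)"
    using prime_imp_coprime[of 3 "A (- p) q"] A_minus_prime_to_3[OF pq]
    by (simp only: coprime_power_left_iff) simp
  moreover have "3 ^ 5 dvd A p q * A (- p) q"
    unfolding prod by (rule dvd_triv_left)
  ultimately obtain x where x: "A p q = 3 ^ 5 * x"
    by (metis coprime_dvd_mult_left_iff dvdE)
  \<comment> \<open>The norm equals \<open>3\<close> to the power \<open>10 + k\<close>, so \<open>3\<close> to the power \<open>10\<close> divides \<open>59 (B p q)\<^sup>2\<close>.\<close>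
  have "59 * (B p q)^2 = (3 ^ 5)^2 * (3 ^ k - 7 * x^2)"
    using norm_A_B[of p q] unfolding N x by (simp add: power_mult_distrib algebra_simps)
  then have "(3 ^ 5)^2 dvd 59 * (B p q)^2"
    by (metis dvd_triv_left)
  moreover have "coprime ((3 ^ 5)^2) (59::int)"
    using prime_imp_coprime[of "3::int" 59] by (simp only: coprime_power_left_iff) simp
  ultimately have "(3 ^ 5)^2 dvd (B p q)^2"
    using coprime_dvd_mult_right_iff by blast
  then have "3 ^ 5 dvd B p q"
    by (subst (asm) pow_divides_pow_iff) auto
  then obtain y where y: "B p q = 3 ^ 5 * y"
    by (auto elim: dvdE)
  have "pp_solution \<bar>x\<bar> \<bar>y\<bar> (2 * m - 5)"
  proof (rule pp_solution_abs)
    show "7 * x^2 + 59 * y^2 = 3 ^ nat (2 * m - 5)"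
      using norm_A_B[of p q] unfolding N x y k_def[symmetric]
      by (simp add: power_mult_distrib)
    show "\<not> 3 dvd x"
    proof
      assume "3 dvd x"
      have "x * A (- p) q = 3 ^ k - 236 * (p * q)^2"
        using prod unfolding x by simp
      moreover have "(3::int) dvd 3 ^ k"
        using \<open>k \<ge> 3\<close> by (simp add: dvd_power)
      ultimately have "3 dvd 236 * (p * q)^2"
        using \<open>3 dvd x\<close> by (metis dvd_mult2 dvd_diff_right_iff)
      then have "3 dvd p * q"
        by (simp add: prime_dvd_mult_iff prime_dvd_power_iff)
      then show False
        using pq by (simp add: cong_def dvd_eq_mod_eq_0)
    qed
    show "2 * m - 5 > 0"
      using m by simp
  qed
  then show ?thesis
    using x y by blast
qed

theorem theorem1:
  fixes q p0 \<omega> :: int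
  assumes "pp_solution q p0 \<omega>"
  shows "\<not> 3 dvd p0 * q \<and>
         (\<exists>!p. p \<in> {p0, - p0} \<and> [p * q = - 1] (mod 3)) \<and>
         (\<forall>p \<in> {p0, - p0}. [p * q = - 1] (mod 3) \<longrightarrow>
            (\<exists>x y :: int.
               rat_of_int x = 3 powi (- 5) * rat_of_int \<bar>A p q\<bar> \<and>
               rat_of_int y = 3 powi (- 5) * rat_of_int \<bar>B p q\<bar> \<and>
               pp_solution x y (2 * \<omega> - 5)) \<and>
            pp_solution \<bar>A (- p) q\<bar> \<bar>B (- p) q\<bar> (2 * \<omega> + 5))"
proof (intro conjI ballI impI)
  have pr: "prime (3::int)"
    by simp
  show *: "\<not> 3 dvd p0 * q"
    using pp_solution_prime_to_3[OF assms] pr by (simp add: prime_dvd_mult_iff)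
  show "\<exists>!p. p \<in> {p0, - p0} \<and> [p * q = - 1] (mod 3)"
    using * by (rule unique_sign_cong_minus_one_mod_3)
next
  fix p assume p: "p \<in> {p0, - p0}" and pq: "[p * q = - 1] (mod 3)"
  have eq: "7 * q^2 + 59 * p^2 = 3 ^ nat \<omega>"
    using assms p by (auto simp: pp_solution_def is_solution_def)
  have \<omega>: "\<omega> \<ge> 4"
    using assms by (rule pp_solution_exponent_ge_4)
  show "pp_solution \<bar>A (- p) q\<bar> \<bar>B (- p) q\<bar> (2 * \<omega> + 5)"
    using eq \<omega> pq by (intro second_successor) auto
  obtain x y where "A p q = 3 ^ 5 * x" "B p q = 3 ^ 5 * y" "pp_solution \<bar>x\<bar> \<bar>y\<bar> (2 * \<omega> - 5)"
    using first_successor[OF eq \<omega> pq] by blast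
  then show "\<exists>x y :: int.
               rat_of_int x = 3 powi (- 5) * rat_of_int \<bar>A p q\<bar> \<and>
               rat_of_int y = 3 powi (- 5) * rat_of_int \<bar>B p q\<bar> \<and>
               pp_solution x y (2 * \<omega> - 5)"
    by (intro exI[of _ "\<bar>x\<bar>"] exI[of _ "\<bar>y\<bar>"]) (simp add: power_int_minus abs_mult)
qed

end
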